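(* For every $n\ge 1$, the map $f: X_n\to U_n$ is a bijection.
   Context: A set $L$ of integers is uncrowded if $|[y,y+2x]\cap L|\le x+1$ for all integers $x,y$ with $x>0$. A standard Young tableau with at most two rows is uncrowded if the set of entries in its second row is uncrowded (in particular, a one-row tableau is uncrowded). $U_n$ is the set of uncrowded standard Young tableaux of size $n$ (with at most two rows, filled with $1,\dots,n$). $X_n$ is the set of words of length $n-1$ in the letters $0,1$ in which every maximal block of consecutive $1$s has odd length. The map $f$ is defined as follows. If $x\in X_n$ is the word all of whose letters are $0$, then $f(x)$ is the one-row tableau with entries $1,2,\dots,n$. Otherwise, for $x=x_1x_2\cdots x_{n-1}\in X_n$, define $\alpha(x)\subset[1,n]$ and $\beta(x)\subset[2,n]$ to be the sets consisting of exactly the following elements: - $1\in\alpha(x)$; - if $x_i=0$, then $n+1-i\in\alpha(x)$; - for each maximal block of $1$s in $x$, starting at index $i$ and ending at index $i+2k$: $n+1-i\in\beta(x)$; and, if $2k>0$, $n+1-j\in\beta(x)$ for all $j\in\{i+1,i+3,\ldots,i+2k-1\}$ and $n+1-j\in\alpha(x)$ for all $j\in\{i+2,i+4,\ldots,i+2k\}$. Then $f(x)$ is the two-row tableau whose first (resp. second) row is the increasing sequence of elements of $\alpha(x)$ (resp. $\beta(x)$). *)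

theory Defs
  imports Main
begin

definition uncrowded :: "int set \<Rightarrow> bool" where
  "uncrowded L \<longleftrightarrow> (\<forall>x y :: int. x > 0 \<longrightarrow> int (card ({y..y + 2 * x} \<inter> L)) \<le> x + 1)"

(* Tableaux in English notation, as the list of their (nonempty) rows from top to bottom. *)
definition standard_young_tableau :: "nat \<Rightarrow> nat list list \<Rightarrow> bool" where
  "standard_young_tableau n T \<longleftrightarrow>
     [] \<notin> set T \<and>
     sorted_wrt (\<ge>) (map length T) \<and>
     distinct (concat T) \<and> set (concat T) = {1..n} \<and>
     (\<forall>r \<in> set T. sorted_wrt (<) r) \<and>
     (\<forall>i j. Suc i < length T \<longrightarrow> j < length (T ! Suc i) \<longrightarrow> T ! i ! j < T ! Suc i ! j)"

definition second_row :: "nat list list \<Rightarrow> nat list" where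
  "second_row T = (if length T \<ge> 2 then T ! 1 else [])"

definition uncrowded_tableaux :: "nat \<Rightarrow> nat list list set" where
  "uncrowded_tableaux n =
     {T. standard_young_tableau n T \<and> length T \<le> 2 \<and> uncrowded (int ` set (second_row T))}"

(* Letters are indexed from 1. *)
definition letter :: "nat list \<Rightarrow> nat \<Rightarrow> nat" where
  "letter x i = x ! (i - 1)"

(* The letters with indices i, ..., j form a maximal block of consecutive 1s. *)
definition maximal_block :: "nat list \<Rightarrow> nat \<Rightarrow> nat \<Rightarrow> bool" where
  "maximal_block x i j \<longleftrightarrow>
     1 \<le> i \<and> i \<le> j \<and> j \<le> length x \<and>
     (\<forall>l \<in> {i..j}. letter x l = 1) \<and>
     (i = 1 \<or> letter x (i - 1) \<noteq> 1) \<and>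
     (j = length x \<or> letter x (j + 1) \<noteq> 1)"

definition odd_block_words :: "nat \<Rightarrow> nat list set" where
  "odd_block_words n =
     {x. length x = n - 1 \<and> set x \<subseteq> {0, 1} \<and>
         (\<forall>i j. maximal_block x i j \<longrightarrow> odd (j - i + 1))}"

definition alpha :: "nat \<Rightarrow> nat list \<Rightarrow> nat set" where
  "alpha n x =
     {1} \<union>
     {n + 1 - i | i. i \<in> {1..n - 1} \<and> letter x i = 0} \<union>
     {n + 1 - (i + 2 * m) | i k m. maximal_block x i (i + 2 * k) \<and> m \<in> {1..k}}"

definition beta :: "nat \<Rightarrow> nat list \<Rightarrow> nat set" where
  "beta n x =
     {n + 1 - i | i k. maximal_block x i (i + 2 * k)} \<union>
     {n + 1 - (i + 2 * m + 1) | i k m. maximal_block x i (i + 2 * k) \<and> m < k}"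

definition word_tableau :: "nat \<Rightarrow> nat list \<Rightarrow> nat list list" where
  "word_tableau n x =
     (if \<forall>l \<in> set x. l = 0 then [[1..<n + 1]]
      else [sorted_list_of_set (alpha n x), sorted_list_of_set (beta n x)])"

end

theory Submission imports Defs begin

text \<open>
  A standard tableau with at most two rows is determined by the set \<open>B\<close> of entries of its second
  row, and \<open>B\<close> occurs exactly when it satisfies the ballot condition: at most half of
  \<open>1, \<dots>, v\<close> lies in \<open>B\<close>, for every \<open>v\<close> (\<open>bij_betw_two_row_tableau\<close>).  So the task is to match the
  words with the uncrowded ballot sets, by \<open>beta\<close>.

  Read the values \<open>n, n - 1, \<dots>, 1\<close> in this order and let a walk start at \<open>0\<close>, step up at the
  elements of \<open>B\<close>, and step down at the others, staying at \<open>0\<close> instead of becoming negative.  The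
  height of such a reflected walk is the largest excess of members over non-members among all
  windows that end at the current value, the empty window included
  (\<open>window_le_height\<close>, \<open>window_attaining_height\<close>).
  Hence both conditions on \<open>B\<close> are conditions on the walk: the ballot condition says that no window
  ending at the value \<open>1\<close> has positive excess, i.e. that the walk ends at \<open>0\<close>, and uncrowdedness,
  which forbids excess \<open>3\<close>, says that the walk never exceeds \<open>2\<close>
  (\<open>uncrowded_ballot_sets_iff_height\<close>).

  Such a walk is a sequence over \<open>{0, 1, 2}\<close>, and the possible transitions are
  \<open>0 \<rightarrow> 0\<close>, \<open>0 \<rightarrow> 1\<close>, \<open>1 \<rightarrow> 0\<close>, \<open>1 \<rightarrow> 2\<close> and \<open>2 \<rightarrow> 1\<close>.  Record after each step but the last, which ends
  at \<open>0\<close> anyway, whether the walk is at \<open>0\<close> (letter \<open>0\<close>) or not (letter \<open>1\<close>): an excursion from \<open>0\<close> is a run \<open>1, 2, 1, 2, \<dots>, 1\<close>, so the result is a word whose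
  blocks of ones have odd length, and the walk is recovered from the word by alternating \<open>1\<close> and
  \<open>2\<close> along each block.  The set \<open>beta n x\<close> is exactly the set of up-steps of the walk recovered
  from \<open>x\<close> (\<open>height_beta_eq_depth\<close>), which makes \<open>beta\<close> a bijection.
\<close>

section \<open>The reflected walk of a set\<close>

text \<open>
  Step \<open>i\<close> reads the value \<open>n + 1 - i\<close>, as letter \<open>i\<close> of a word does.  Truncated subtraction is the
  reflection at \<open>0\<close>.
\<close>
primrec height :: "nat \<Rightarrow> nat set \<Rightarrow> nat \<Rightarrow> nat" where
  "height n B 0 = 0"
| "height n B (Suc i) = (if n - i \<in> B then Suc (height n B i) else height n B i - 1)"

lemma window_Suc:
  assumes "Suc j \<le> n" "i \<le> j"
  shows "card (B \<inter> {n - Suc j<..n - i}) = card (B \<inter> {n - j<..n - i}) + (if n - j \<in> B then 1 else 0)"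
proof -
  have "{n - Suc j<..n - i} = insert (n - j) {n - j<..n - i}"
    using assms by auto
  then show ?thesis by auto
qed

text \<open>
  The next two lemmas together identify the height after \<open>j\<close> steps as the maximal excess of a window
  \<open>{n - j<..n - i}\<close>: a step changes the excess of every nonempty window by the same amount, and the
  empty window starting afresh accounts for the reflection.  An excess may be negative, so it is
  expressed additively, through the window length \<open>j - i\<close>.
\<close>
lemma window_le_height:
  assumes "j \<le> n" "i \<le> j"
  shows "2 * card (B \<inter> {n - j<..n - i}) \<le> height n B j + (j - i)"
  using assms
proof (induction j)
  case (Suc j)
  show ?case
  proof (cases "i = Suc j")
    case False
    then have "i \<le> j" using Suc.prems by simp
    then show ?thesis
      using Suc.IH Suc.prems window_Suc[of j n i B] by (simp split: if_splits; linarith)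
  qed simp
qed simp

lemma window_attaining_height:
  assumes "j \<le> n"
  obtains i where "i \<le> j" "2 * card (B \<inter> {n - j<..n - i}) = height n B j + (j - i)"
proof -
  have "\<exists>i\<le>j. 2 * card (B \<inter> {n - j<..n - i}) = height n B j + (j - i)"
    using assms
  proof (induction j)
    case (Suc j)
    show ?case
    proof (cases "height n B (Suc j) = 0")
      case True
      then show ?thesis by (intro exI[of _ "Suc j"]) simp
    next
      case False
      obtain i where "i \<le> j" "2 * card (B \<inter> {n - j<..n - i}) = height n B j + (j - i)"
        using Suc by auto
      then show ?thesis
        using False Suc.prems window_Suc[of j n i B]
        by (intro exI[of _ i]) (auto split: if_splits)
    qed
  qed simp
  then show ?thesis using that by blast
qed

text \<open>
  The windows ending at the last step are the initial segments of \<open>{1..n}\<close>.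
\<close>
lemma ballot_iff_height_0:
  assumes "B \<subseteq> {1..n}"
  shows "(\<forall>v\<le>n. 2 * card (B \<inter> {..v}) \<le> v) \<longleftrightarrow> height n B n = 0"
proof -
  have window: "B \<inter> {0<..v} = B \<inter> {..v}" for v
    using assms by auto
  show ?thesis
  proof
    assume ballot: "\<forall>v\<le>n. 2 * card (B \<inter> {..v}) \<le> v"
    obtain i where i: "i \<le> n" "2 * card (B \<inter> {n - n<..n - i}) = height n B n + (n - i)"
      using window_attaining_height[of n n B] by auto
    have "2 * card (B \<inter> {..n - i}) \<le> n - i"
      using ballot by simp
    then show "height n B n = 0"
      using i by (simp add: window)
  next
    assume "height n B n = 0"
    then have "2 * card (B \<inter> {..v}) \<le> v" if "v \<le> n" for v
      using window_le_height[of n n "n - v" B] that by (simp add: window)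
    then show "\<forall>v\<le>n. 2 * card (B \<inter> {..v}) \<le> v" by blast
  qed
qed

text \<open>
  Since the walk climbs by single steps, it passes through \<open>3\<close> before going higher; a window of
  excess \<open>3\<close> has odd length \<open>2 * x + 1\<close> with \<open>x + 2\<close> members, one too many.
\<close>
lemma uncrowded_imp_height_le_2:
  assumes unc: "uncrowded (int ` B)" and "j \<le> n"
  shows "height n B j \<le> 2"
  using \<open>j \<le> n\<close>
proof (induction j)
  case (Suc j)
  show ?case
  proof (rule ccontr)
    assume "\<not> ?thesis"
    then have h: "height n B (Suc j) = 3"
      using Suc by (auto split: if_splits)
    obtain i where i: "i \<le> Suc j"
      "2 * card (B \<inter> {n - Suc j<..n - i}) = 3 + (Suc j - i)"
      using window_attaining_height[of "Suc j" n B] h Suc.prems by auto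
    define c where "c = card (B \<inter> {n - Suc j<..n - i})"
    define x where "x = c - 2"
    have "c \<le> card {n - Suc j<..n - i}"
      unfolding c_def by (rule card_mono) auto
    then have "c \<le> Suc j - i"
      using i(1) Suc.prems by simp
    then have c: "c \<ge> 3" and len: "Suc j - i = 2 * x + 1" and cx: "c = x + 2"
      using i(2) unfolding c_def[symmetric] x_def by auto
    define y where "y = n - Suc j + 1"
    have "{int y..int y + 2 * int x} = int ` {n - Suc j<..n - i}"
      using len i(1) Suc.prems
      by (auto simp: y_def image_int_atLeastAtMost atLeastSucAtMost_greaterThanAtMost[symmetric])
    then have "{int y..int y + 2 * int x} \<inter> int ` B = int ` (B \<inter> {n - Suc j<..n - i})"
      by auto
    then have "card ({int y..int y + 2 * int x} \<inter> int ` B) = c"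
      by (simp add: c_def card_image)
    moreover have "int (card ({int y..int y + 2 * int x} \<inter> int ` B)) \<le> int x + 1"
      using unc c cx unfolding uncrowded_def by auto
    ultimately show False using cx by simp
  qed
qed simp

text \<open>
  An interval of \<open>2 * x + 1\<close> integers is first clipped to \<open>{1..n}\<close>.  What remains has excess at most
  \<open>2\<close>, so its member count is at most half of \<open>2 * x + 3\<close>, that is, at most \<open>x + 1\<close>.
\<close>
lemma height_le_2_imp_uncrowded:
  assumes B: "B \<subseteq> {1..n}" and h: "\<And>j. j \<le> n \<Longrightarrow> height n B j \<le> 2"
  shows "uncrowded (int ` B)"
  unfolding uncrowded_def
proof (intro allI impI)
  fix x y :: int
  assume "x > 0"
  \<comment> \<open>The clipped interval is \<open>{a<..b}\<close>; when it is empty, \<open>b < a\<close> may occur.\<close>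
  define a where "a = nat (max 1 y) - 1"
  define b where "b = nat (min (int n) (y + 2 * x))"
  have sub: "{y..y + 2 * x} \<inter> int ` B \<subseteq> int ` (B \<inter> {a<..b})"
    using B by (force simp: a_def b_def)
  have card: "card ({y..y + 2 * x} \<inter> int ` B) \<le> card (B \<inter> {a<..b})"
    using card_mono[OF _ sub] by (simp add: card_image)
  show "int (card ({y..y + 2 * x} \<inter> int ` B)) \<le> x + 1"
  proof (cases "a \<le> b")
    case True
    then have "a \<le> n" "b \<le> n"
      by (auto simp: b_def)
    have "2 * card (B \<inter> {a<..b}) \<le> height n B (n - a) + (b - a)"
      using window_le_height[of "n - a" n "n - b" B] \<open>a \<le> n\<close> \<open>b \<le> n\<close> True
      by (simp add: diff_le_mono2)
    then have "2 * card (B \<inter> {a<..b}) \<le> 2 + (b - a)"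
      using h[of "n - a"] by linarith
    moreover have "int (b - a) \<le> 2 * x + 1"
      using True \<open>x > 0\<close> by (auto simp: a_def b_def)
    ultimately show ?thesis using card by linarith
  qed (use card \<open>x > 0\<close> in simp)
qed

definition uncrowded_ballot_sets :: "nat \<Rightarrow> nat set set" where
  "uncrowded_ballot_sets n =
     {B. B \<subseteq> {1..n} \<and> (\<forall>v\<le>n. 2 * card (B \<inter> {..v}) \<le> v) \<and> uncrowded (int ` B)}"

lemma uncrowded_ballot_sets_iff_height:
  "B \<in> uncrowded_ballot_sets n \<longleftrightarrow>
     B \<subseteq> {1..n} \<and> height n B n = 0 \<and> (\<forall>j\<le>n. height n B j \<le> 2)"
proof (cases "B \<subseteq> {1..n}")
  case True
  have "uncrowded (int ` B) \<longleftrightarrow> (\<forall>j\<le>n. height n B j \<le> 2)"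
    using uncrowded_imp_height_le_2[of B _ n] height_le_2_imp_uncrowded[OF True] by blast
  then show ?thesis
    using True ballot_iff_height_0[OF True] by (simp add: uncrowded_ballot_sets_def)
qed (simp add: uncrowded_ballot_sets_def)

section \<open>Position of a letter within its block\<close>

text \<open>
  The walk that a word encodes: \<open>0\<close> outside the blocks of ones and \<open>1, 2, 1, 2, \<dots>\<close> along each block.
  Beyond its end the word is continued by zeros.
\<close>
primrec depth :: "nat list \<Rightarrow> nat \<Rightarrow> nat" where
  "depth x 0 = 0"
| "depth x (Suc i) =
     (if i < length x \<and> letter x (Suc i) = 1 then (if depth x i = 1 then 2 else 1) else 0)"

lemma depth_pos_iff: "depth x l > 0 \<longleftrightarrow> l \<in> {1..length x} \<and> letter x l = 1"
  by (cases l) auto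

lemma depth_eq_0_iff: "depth x l = 0 \<longleftrightarrow> \<not> (l \<in> {1..length x} \<and> letter x l = 1)"
  using depth_pos_iff[of x l] by auto

lemma depth_in_block:
  assumes "maximal_block x i j" "i + m \<le> j"
  shows "depth x (i + m) = (if even m then 1 else 2)"
  using assms(2)
proof (induction m)
  case 0
  obtain i' where i': "i = Suc i'"
    using assms(1) by (cases i) (auto simp: maximal_block_def)
  have "depth x i' = 0"
    using assms(1) by (auto simp: maximal_block_def depth_eq_0_iff i')
  then show ?case
    using assms(1) 0 by (auto simp: maximal_block_def i')
next
  case (Suc m)
  then have "letter x (Suc (i + m)) = 1" "i + m < length x"
    using assms(1) by (auto simp: maximal_block_def)
  then show ?case
    using Suc by auto
qed

lemma depth_before_block:
  assumes "maximal_block x i j"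
  shows "depth x (i - 1) = 0"
  using assms by (auto simp: maximal_block_def depth_eq_0_iff)

lemma depth_after_block:
  assumes "maximal_block x i j"
  shows "depth x (Suc j) = 0"
  using assms by (auto simp: maximal_block_def)

lemma in_maximal_block:
  assumes "l \<in> {1..length x}" "letter x l = 1"
  obtains i j where "maximal_block x i j" "i \<le> l" "l \<le> j"
proof -
  define P where "P i \<longleftrightarrow> 1 \<le> i \<and> i \<le> l \<and> (\<forall>m\<in>{i..l}. letter x m = 1)" for i
  define Q where "Q j \<longleftrightarrow> l \<le> j \<and> j \<le> length x \<and> (\<forall>m\<in>{l..j}. letter x m = 1)" for j
  define i where "i = (LEAST i. P i)"
  define j where "j = (GREATEST j. Q j)"
  have "P l" "Q l" using assms by (auto simp: P_def Q_def)
  have Pi: "P i" unfolding i_def using \<open>P l\<close> by (rule LeastI)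
  have Qj: "Q j" unfolding j_def
    using \<open>Q l\<close> by (rule GreatestI_nat) (auto simp: Q_def)
  have "letter x (i - 1) \<noteq> 1" if "i \<noteq> 1"
  proof
    assume "letter x (i - 1) = 1"
    moreover have "{i - 1..l} = insert (i - 1) {i..l}"
      using Pi that by (auto simp: P_def)
    ultimately have "P (i - 1)"
      using Pi that by (auto simp: P_def)
    then have "i \<le> i - 1"
      unfolding i_def by (rule Least_le)
    then show False using Pi by (auto simp: P_def)
  qed
  moreover have "letter x (j + 1) \<noteq> 1" if "j \<noteq> length x"
  proof
    assume "letter x (j + 1) = 1"
    moreover have "{l..j + 1} = insert (j + 1) {l..j}"
      using Qj by (auto simp: Q_def)
    ultimately have "Q (j + 1)"
      using Qj that by (auto simp: Q_def)
    then have "j + 1 \<le> j"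
      unfolding j_def by (rule Greatest_le_nat) (auto simp: Q_def)
    then show False by simp
  qed
  moreover have "letter x m = 1" if "m \<in> {i..j}" for m
    using Pi Qj that by (cases "m \<le> l") (auto simp: P_def Q_def)
  ultimately have "maximal_block x i j"
    using Pi Qj by (auto simp: maximal_block_def P_def Q_def)
  then show ?thesis
    using that Pi Qj by (auto simp: P_def Q_def)
qed

text \<open>
  The depth at the end of a block is \<open>1\<close> or \<open>2\<close> according to whether its length is odd or even, so a
  block of even length shows up as a fall from \<open>2\<close> to \<open>0\<close>, the one transition a walk cannot make.
\<close>
lemma odd_blocks_iff_depth:
  "(\<forall>i j. maximal_block x i j \<longrightarrow> odd (j - i + 1)) \<longleftrightarrow>
     (\<forall>l. depth x l = 2 \<longrightarrow> depth x (Suc l) \<noteq> 0)"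
proof
  assume odd: "\<forall>i j. maximal_block x i j \<longrightarrow> odd (j - i + 1)"
  show "\<forall>l. depth x l = 2 \<longrightarrow> depth x (Suc l) \<noteq> 0"
  proof (intro allI impI)
    fix l assume l: "depth x l = 2"
    then have "l \<in> {1..length x} \<and> letter x l = 1"
      using depth_pos_iff[of x l] by simp
    then obtain i j where ij: "maximal_block x i j" "i \<le> l" "l \<le> j"
      using in_maximal_block by metis
    have "odd (l - i)"
      using depth_in_block[OF ij(1), of "l - i"] ij l by (auto split: if_splits)
    moreover have "even (j - i)"
      using odd ij(1) by auto
    ultimately have "l < j"
      using ij by (cases "l = j") auto
    then have "depth x (i + (Suc l - i)) \<noteq> 0"
      using depth_in_block[OF ij(1), of "Suc l - i"] ij by auto
    then show "depth x (Suc l) \<noteq> 0"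
      using ij(2) by simp
  qed
next
  assume step: "\<forall>l. depth x l = 2 \<longrightarrow> depth x (Suc l) \<noteq> 0"
  show "\<forall>i j. maximal_block x i j \<longrightarrow> odd (j - i + 1)"
  proof (intro allI impI)
    fix i j assume ij: "maximal_block x i j"
    then have "i \<le> j" by (simp add: maximal_block_def)
    then have "depth x j = (if even (j - i) then 1 else 2)"
      using depth_in_block[OF ij, of "j - i"] by simp
    then show "odd (j - i + 1)"
      using step depth_after_block[OF ij] by (auto split: if_splits)
  qed
qed

lemma depth_step_in_block:
  assumes "maximal_block x i j" "i \<le> l" "l \<le> j"
  shows "depth x (l - 1) < depth x l \<longleftrightarrow> l = i \<or> odd (l - i)"
proof (cases "l = i")
  case True
  then show ?thesis
    using depth_before_block[OF assms(1)] depth_in_block[OF assms(1), of 0] assms by simp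
next
  case False
  then have "depth x (l - 1) = (if even (l - 1 - i) then 1 else 2)"
    "depth x l = (if even (l - i) then 1 else 2)"
    using depth_in_block[OF assms(1), of "l - 1 - i"] depth_in_block[OF assms(1), of "l - i"] assms
    by auto
  moreover have "even (l - 1 - i) \<longleftrightarrow> odd (l - i)"
    using False assms by (metis Suc_diff_Suc diff_Suc_eq_diff_pred even_Suc le_neq_implies_less)
  ultimately show ?thesis
    using False by auto
qed

section \<open>The second row of the tableau of a word\<close>

lemma odd_block_wordsD:
  assumes "x \<in> odd_block_words n"
  shows "length x = n - 1" "set x \<subseteq> {0, 1}" "maximal_block x i j \<Longrightarrow> odd (j - i + 1)"
  using assms unfolding odd_block_words_def by blast+

text \<open>
  In a block starting at \<open>i\<close>, the depth rises at \<open>i\<close> itself (from \<open>0\<close>) and at every odd offset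
  (from \<open>1\<close> to \<open>2\<close>); these are the positions that \<open>beta\<close> selects.
\<close>
lemma beta_eq_ascents:
  assumes "x \<in> odd_block_words n"
  shows "beta n x = {n + 1 - l | l. l \<in> {1..n - 1} \<and> depth x (l - 1) < depth x l}"
    (is "_ = ?R")
proof
  have len: "length x = n - 1" using odd_block_wordsD(1)[OF assms] .
  show "beta n x \<subseteq> ?R"
  proof
    fix v assume "v \<in> beta n x"
    then obtain i k l where b: "maximal_block x i (i + 2 * k)" and v: "v = n + 1 - l"
      and l: "i \<le> l" "l \<le> i + 2 * k" "l = i \<or> odd (l - i)"
      unfolding beta_def by fastforce
    moreover have "l \<in> {1..n - 1}"
      using b l len by (auto simp: maximal_block_def)
    ultimately show "v \<in> ?R"
      using depth_step_in_block[OF b l(1,2)] by blast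
  qed
  show "?R \<subseteq> beta n x"
  proof
    fix v assume "v \<in> ?R"
    then obtain l where v: "v = n + 1 - l" and l: "depth x (l - 1) < depth x l"
      by blast
    then have "l \<in> {1..length x} \<and> letter x l = 1"
      using depth_pos_iff[of x l] by simp
    then obtain i j where ij: "maximal_block x i j" "i \<le> l" "l \<le> j"
      using in_maximal_block by metis
    have "odd (j - i + 1)"
      using odd_block_wordsD(3)[OF assms ij(1)] .
    then have "even (j - i)" by simp
    then obtain k where "j - i = 2 * k" by blast
    then have k: "j = i + 2 * k" using ij by simp
    consider "l = i" | "odd (l - i)"
      using depth_step_in_block[OF ij] l by blast
    then show "v \<in> beta n x"
    proof cases
      case 1
      then show ?thesis using ij(1) v k unfolding beta_def by blast
    next
      case 2
      then obtain m where "l - i = 2 * m + 1" by (rule oddE)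
      then have "l = i + 2 * m + 1" "m < k" using ij k by auto
      then show ?thesis using ij(1) v k unfolding beta_def by blast
    qed
  qed
qed

lemma alpha_eq_non_ascents:
  assumes "x \<in> odd_block_words n"
  shows "alpha n x = {1} \<union> {n + 1 - l | l. l \<in> {1..n - 1} \<and> \<not> depth x (l - 1) < depth x l}"
    (is "_ = {1} \<union> ?R")
proof
  have len: "length x = n - 1" and bits: "set x \<subseteq> {0, 1}"
    using odd_block_wordsD[OF assms] by blast+
  have zero: "depth x l = 0" if "letter x l = 0" for l
    using that by (auto simp: depth_eq_0_iff)
  show "alpha n x \<subseteq> {1} \<union> ?R"
  proof
    fix v assume "v \<in> alpha n x"
    then consider "v = 1"
      | l where "v = n + 1 - l" "l \<in> {1..n - 1}" "letter x l = 0"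
      | i k m where "maximal_block x i (i + 2 * k)" "m \<in> {1..k}" "v = n + 1 - (i + 2 * m)"
      unfolding alpha_def by blast
    then show "v \<in> {1} \<union> ?R"
    proof cases
      case 2
      then show ?thesis using zero[of l] by auto
    next
      case 3
      then have "i + 2 * m \<in> {1..n - 1}"
        using len by (auto simp: maximal_block_def)
      moreover have "\<not> depth x (i + 2 * m - 1) < depth x (i + 2 * m)"
        using depth_step_in_block[OF 3(1), of "i + 2 * m"] 3(2) by simp
      ultimately show ?thesis using 3(3) by blast
    qed simp
  qed
  show "{1} \<union> ?R \<subseteq> alpha n x"
  proof
    fix v assume "v \<in> {1} \<union> ?R"
    then consider "v = 1"
      | l where "v = n + 1 - l" "l \<in> {1..n - 1}" "\<not> depth x (l - 1) < depth x l"
      by blast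
    then show "v \<in> alpha n x"
    proof cases
      case 1
      then show ?thesis by (simp add: alpha_def)
    next
      case 2
      show ?thesis
      proof (cases "letter x l = 1")
        case True
        then obtain i j where ij: "maximal_block x i j" "i \<le> l" "l \<le> j"
          using in_maximal_block[of l x] 2(2) len by metis
        have "odd (j - i + 1)"
          using odd_block_wordsD(3)[OF assms ij(1)] .
        then have "even (j - i)" by simp
        then obtain k where "j - i = 2 * k" by blast
        then have k: "j = i + 2 * k" using ij by simp
        have "l \<noteq> i" "even (l - i)"
          using depth_step_in_block[OF ij] 2(3) by blast+
        moreover from this obtain m where "l - i = 2 * m" by blast
        ultimately have "l = i + 2 * m" "m \<in> {1..k}" using ij k by auto
        then show ?thesis using ij(1) 2(1) k unfolding alpha_def by blast
      next
        case False
        moreover have "letter x l \<in> set x"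
          using 2(2) len by (auto simp: letter_def)
        ultimately have "letter x l = 0" using bits by auto
        then show ?thesis using 2 unfolding alpha_def by blast
      qed
    qed
  qed
qed

text \<open>
  Every value from \<open>2\<close> to \<open>n\<close> belongs to exactly one letter, which is an ascent or not; the
  value \<open>1\<close> belongs to no letter.
\<close>
lemma alpha_eq_complement:
  assumes "x \<in> odd_block_words n" "n \<ge> 1"
  shows "alpha n x = {1..n} - beta n x"
proof (rule set_eqI)
  fix v
  have idx: "v \<in> {n + 1 - l | l. l \<in> {1..n - 1} \<and> P l} \<longleftrightarrow> v \<in> {2..n} \<and> P (n + 1 - v)" for P
    by (auto intro!: exI[of _ "n + 1 - v"])
  have "v \<in> {1..n} \<longleftrightarrow> v = 1 \<or> v \<in> {2..n}"
    using assms(2) by auto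
  then show "v \<in> alpha n x \<longleftrightarrow> v \<in> {1..n} - beta n x"
    unfolding alpha_eq_non_ascents[OF assms(1)] beta_eq_ascents[OF assms(1)] Un_iff Diff_iff idx
    by auto
qed

text \<open>
  For \<open>i = n - 1\<close>, the value \<open>1\<close> is read: the depth at \<open>n\<close>, beyond the end of the word, is \<open>0\<close>, so both
  sides are false.
\<close>
lemma mem_beta_iff_ascent:
  assumes "x \<in> odd_block_words n" "i < n"
  shows "n - i \<in> beta n x \<longleftrightarrow> depth x i < depth x (Suc i)"
proof -
  have "n - i \<in> beta n x \<longleftrightarrow> i < n - 1 \<and> depth x i < depth x (Suc i)"
  proof
    assume "n - i \<in> beta n x"
    then obtain l where l: "n - i = n + 1 - l" "l \<in> {1..n - 1}" "depth x (l - 1) < depth x l"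
      unfolding beta_eq_ascents[OF assms(1)] by blast
    then have "l = Suc i" using assms(2) by auto
    then show "i < n - 1 \<and> depth x i < depth x (Suc i)" using l by auto
  next
    assume "i < n - 1 \<and> depth x i < depth x (Suc i)"
    then show "n - i \<in> beta n x"
      unfolding beta_eq_ascents[OF assms(1)] by (auto intro!: exI[of _ "Suc i"])
  qed
  then show ?thesis
    using odd_block_wordsD(1)[OF assms(1)] depth_pos_iff[of x "Suc i"] by auto
qed

lemma depth_le_2: "depth x i \<le> 2"
  by (cases i) auto

text \<open>
  Where the depth does not rise, it falls by one or stays at \<open>0\<close>, because the fall from \<open>2\<close> to \<open>0\<close> is
  excluded by the parity of the blocks; this is the step rule of the reflected walk.
\<close>
lemma height_beta_eq_depth:
  assumes "x \<in> odd_block_words n" "i \<le> n"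
  shows "height n (beta n x) i = depth x i"
  using assms(2)
proof (induction i)
  case (Suc i)
  have "depth x i = 2 \<longrightarrow> depth x (Suc i) \<noteq> 0"
    using odd_blocks_iff_depth[of x] odd_block_wordsD(3)[OF assms(1)] by blast
  moreover have "depth x (Suc i) = 0 \<or> depth x (Suc i) = (if depth x i = 1 then 2 else 1)"
    by simp
  moreover have "n - i \<in> beta n x \<longleftrightarrow> depth x i < depth x (Suc i)"
    using mem_beta_iff_ascent[OF assms(1), of i] Suc.prems by simp
  moreover have "depth x i = 0 \<or> depth x i = 1 \<or> depth x i = 2"
    using depth_le_2[of x i] by linarith
  ultimately show ?case
    using Suc by (auto simp del: depth.simps)
qed simp

lemma beta_subset: "x \<in> odd_block_words n \<Longrightarrow> beta n x \<subseteq> {1..n}"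
  by (auto simp: beta_eq_ascents)

lemma beta_in_uncrowded_ballot_sets:
  assumes "x \<in> odd_block_words n" "n \<ge> 1"
  shows "beta n x \<in> uncrowded_ballot_sets n"
proof -
  have "depth x n = 0"
    using odd_block_wordsD(1)[OF assms(1)] assms(2) by (auto simp: depth_eq_0_iff)
  then show ?thesis
    using assms beta_subset height_beta_eq_depth[OF assms(1)] depth_le_2
    by (simp add: uncrowded_ballot_sets_iff_height)
qed

lemma words_eqI_letter:
  assumes "length x = length y" "\<And>i. i \<in> {1..length x} \<Longrightarrow> letter x i = letter y i"
  shows "x = y"
proof (rule nth_equalityI)
  show "x ! i = y ! i" if "i < length x" for i
    using assms(2)[of "Suc i"] that unfolding letter_def by simp
qed (rule assms(1))

text \<open>
  The set determines its walk, hence the depths, and a letter is \<open>1\<close> iff its depth is positive.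
\<close>
lemma inj_on_beta: "inj_on (beta n) (odd_block_words n)"
proof (rule inj_onI)
  fix x y
  assume x: "x \<in> odd_block_words n" and y: "y \<in> odd_block_words n" and eq: "beta n x = beta n y"
  have len: "length x = n - 1" "length y = n - 1"
    and bits: "set x \<subseteq> {0, 1}" "set y \<subseteq> {0, 1}"
    using odd_block_wordsD x y by blast+
  show "x = y"
  proof (rule words_eqI_letter)
    fix i assume i: "i \<in> {1..length x}"
    then have "i \<le> n" using len by auto
    then have "depth x i = depth y i"
      using height_beta_eq_depth[OF x, of i] height_beta_eq_depth[OF y, of i] eq len by simp
    then have "letter x i = 1 \<longleftrightarrow> letter y i = 1"
      using depth_pos_iff[of x i] depth_pos_iff[of y i] i len by auto
    moreover have "letter x i \<in> set x" "letter y i \<in> set y"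
      using i len by (auto simp: letter_def)
    ultimately show "letter x i = letter y i"
      using bits by fastforce
  qed (simp add: len)
qed

text \<open>
  The word marks where the walk of \<open>B\<close> is away from \<open>0\<close>.  A walk confined to \<open>{0, 1, 2}\<close> is forced to
  alternate between \<open>1\<close> and \<open>2\<close> during an excursion, so its heights are the depths of this word.
\<close>
lemma uncrowded_ballot_set_is_beta:
  assumes B: "B \<in> uncrowded_ballot_sets n" and n: "n \<ge> 1"
  obtains x where "x \<in> odd_block_words n" "beta n x = B"
proof -
  have sub: "B \<subseteq> {1..n}" and last: "height n B n = 0" and le2: "\<And>j. j \<le> n \<Longrightarrow> height n B j \<le> 2"
    using B by (auto simp: uncrowded_ballot_sets_iff_height)
  define x where "x = map (\<lambda>i. if height n B (Suc i) = 0 then 0 else 1 :: nat) [0..<n - 1]"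
  have len: "length x = n - 1" by (simp add: x_def)
  have letter: "letter x (Suc i) = 1 \<longleftrightarrow> height n B (Suc i) \<noteq> 0" if "i < n - 1" for i
    using that by (simp add: letter_def x_def)
  have depth: "depth x i = height n B i" if "i \<le> n" for i
    using that
  proof (induction i)
    case (Suc i)
    have "i < n - 1 \<or> height n B (Suc i) = 0"
      using last Suc.prems by (cases "Suc i = n") auto
    then show ?case
      using Suc letter[of i] le2[of "Suc i"] le2[of i] len by (auto simp: split: if_splits)
  qed simp
  have "depth x (Suc l) \<noteq> 0" if l: "depth x l = 2" for l
  proof -
    have "l \<le> n - 1"
      using l depth_pos_iff[of x l] len by simp
    then show ?thesis
      using l depth[of l] depth[of "Suc l"] n by (simp split: if_splits)
  qed
  then have x: "x \<in> odd_block_words n"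
    using odd_blocks_iff_depth[of x] len unfolding odd_block_words_def
    by (auto simp: x_def simp del: depth.simps)
  have "beta n x = B"
  proof (rule set_eqI)
    fix v
    show "v \<in> beta n x \<longleftrightarrow> v \<in> B"
    proof (cases "v \<in> {1..n}")
      case True
      define i where "i = n - v"
      have i: "i < n" "n - i = v" using True by (auto simp: i_def)
      have "v \<in> beta n x \<longleftrightarrow> height n B i < height n B (Suc i)"
        using mem_beta_iff_ascent[OF x i(1)] i depth[of i] depth[of "Suc i"] by simp
      also have "\<dots> \<longleftrightarrow> v \<in> B"
        using i by auto
      finally show ?thesis .
    next
      case False
      then show ?thesis using beta_subset[OF x] sub by blast
    qed
  qed
  then show ?thesis using that x by blast
qed

lemma bij_betw_beta:
  assumes "n \<ge> 1"
  shows "bij_betw (beta n) (odd_block_words n) (uncrowded_ballot_sets n)"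
proof -
  have "beta n ` odd_block_words n = uncrowded_ballot_sets n"
  proof (intro equalityI subsetI)
    fix B assume "B \<in> uncrowded_ballot_sets n"
    then obtain x where "x \<in> odd_block_words n" "beta n x = B"
      using uncrowded_ballot_set_is_beta assms by blast
    then show "B \<in> beta n ` odd_block_words n" by blast
  qed (use assms beta_in_uncrowded_ballot_sets in blast)
  then show ?thesis
    using inj_on_beta by (simp add: bij_betw_def)
qed

section \<open>Two-row tableaux and ballot sets\<close>

definition two_row_tableau :: "nat \<Rightarrow> nat set \<Rightarrow> nat list list" where
  "two_row_tableau n B =
     (if B = {} then [[1..<n + 1]]
      else [sorted_list_of_set ({1..n} - B), sorted_list_of_set B])"

lemma nth_le_iff_card:
  fixes xs :: "nat list"
  assumes "sorted_wrt (<) xs" "j < length xs"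
  shows "xs ! j \<le> v \<longleftrightarrow> j < card (set xs \<inter> {..v})"
  using assms
proof (induction xs arbitrary: j)
  case (Cons a xs)
  show ?case
  proof (cases "a \<le> v")
    case True
    have "set (a # xs) \<inter> {..v} = insert a (set xs \<inter> {..v})" "a \<notin> set xs"
      using True Cons.prems by auto
    then have "card (set (a # xs) \<inter> {..v}) = Suc (card (set xs \<inter> {..v}))"
      by simp
    then show ?thesis
      using Cons True by (cases j) auto
  next
    case False
    then have none: "set (a # xs) \<inter> {..v} = {}"
      using Cons.prems by auto
    moreover have "(a # xs) ! j \<in> set (a # xs)"
      using Cons.prems by (intro nth_mem)
    ultimately show ?thesis by auto
  qed
qed simp

text \<open>
  By \<open>nth_le_iff_card\<close>, the columns increase iff, for every \<open>v\<close>, the second row has at most as many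
  entries up to \<open>v\<close> as the first row has; the two numbers add up to \<open>v\<close>.  Taking \<open>v = n\<close> gives the
  comparison of the row lengths.
\<close>
lemma columns_increasing_iff_ballot:
  fixes r s :: "nat list"
  assumes r: "sorted_wrt (<) r" and s: "sorted_wrt (<) s"
    and disj: "set r \<inter> set s = {}" and un: "set r \<union> set s = {1..n}"
  shows "length s \<le> length r \<and> (\<forall>j<length s. r ! j < s ! j) \<longleftrightarrow>
         (\<forall>v\<le>n. 2 * card (set s \<inter> {..v}) \<le> v)"
proof -
  have count: "card (set r \<inter> {..v}) + card (set s \<inter> {..v}) = v" if "v \<le> n" for v
  proof -
    have "card ((set r \<inter> {..v}) \<union> (set s \<inter> {..v})) = card {1..v}"
      using un that by (intro arg_cong[of _ _ card]) auto
    then show ?thesis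
      using disj by (subst (asm) card_Un_disjoint) auto
  qed
  have size: "card (set r) = length r" "card (set s) = length s"
    using r s by (auto simp: distinct_card strict_sorted_iff)
  show ?thesis
  proof (intro iffI conjI allI impI)
    fix v assume rs: "length s \<le> length r \<and> (\<forall>j<length s. r ! j < s ! j)" and v: "v \<le> n"
    show "2 * card (set s \<inter> {..v}) \<le> v"
    proof (cases "card (set s \<inter> {..v})")
      case (Suc c)
      have "card (set s \<inter> {..v}) \<le> card (set s)"
        by (rule card_mono) auto
      then have c: "c < length s" using Suc size by simp
      then have "s ! c \<le> v"
        using nth_le_iff_card[OF s c, of v] Suc by simp
      then have "r ! c \<le> v" "c < length r"
        using rs c by (auto intro: less_imp_le less_le_trans)
      then have "c < card (set r \<inter> {..v})"
        using nth_le_iff_card[OF r] by blast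
      then show ?thesis using count[OF v] Suc by simp
    qed simp
  next
    assume ballot: "\<forall>v\<le>n. 2 * card (set s \<inter> {..v}) \<le> v"
    have all: "set r \<inter> {..n} = set r" "set s \<inter> {..n} = set s"
      using un by auto
    show len: "length s \<le> length r"
      using count[of n] ballot[rule_format, of n] by (simp add: all size)
    fix j assume j: "j < length s"
    then have jr: "j < length r" using len by simp
    have mem: "s ! j \<in> set s" "r ! j \<in> set r" using j jr by auto
    then have v: "s ! j \<le> n" using un by auto
    have "j < card (set s \<inter> {..s ! j})"
      using nth_le_iff_card[OF s j, of "s ! j"] by simp
    then have "j < card (set r \<inter> {..s ! j})"
      using count[OF v] ballot[rule_format, OF v] by simp
    then have "r ! j \<le> s ! j"
      using nth_le_iff_card[OF r jr] by blast
    then show "r ! j < s ! j"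
      using mem disj by (metis IntI empty_iff le_neq_implies_less)
  qed
qed

text \<open>
  With \<open>s\<close> nonempty, \<open>r\<close> is nonempty by the comparison of lengths that the ballot condition contains.
\<close>
lemma two_rows_standard_iff:
  assumes "s \<noteq> []"
  shows "standard_young_tableau n [r, s] \<longleftrightarrow>
     sorted_wrt (<) r \<and> sorted_wrt (<) s \<and> set r \<inter> set s = {} \<and> set r \<union> set s = {1..n} \<and>
     (\<forall>v\<le>n. 2 * card (set s \<inter> {..v}) \<le> v)" (is "?L \<longleftrightarrow> ?R")
proof -
  have cols: "(\<forall>i j. Suc i < length [r, s] \<longrightarrow> j < length ([r, s] ! Suc i) \<longrightarrow>
      [r, s] ! i ! j < [r, s] ! Suc i ! j) \<longleftrightarrow> (\<forall>j<length s. r ! j < s ! j)"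
    by auto
  have "?L \<longleftrightarrow> r \<noteq> [] \<and> sorted_wrt (<) r \<and> sorted_wrt (<) s \<and> set r \<inter> set s = {} \<and>
      set r \<union> set s = {1..n} \<and> length s \<le> length r \<and> (\<forall>j<length s. r ! j < s ! j)"
    unfolding standard_young_tableau_def cols using assms
    by (auto simp: strict_sorted_iff)
  also have "\<dots> \<longleftrightarrow> sorted_wrt (<) r \<and> sorted_wrt (<) s \<and> set r \<inter> set s = {} \<and>
      set r \<union> set s = {1..n} \<and> length s \<le> length r \<and> (\<forall>j<length s. r ! j < s ! j)"
    using assms by auto
  finally show ?thesis
    using columns_increasing_iff_ballot[of r s n] by blast
qed

lemma one_row_standard_iff:
  assumes "n \<ge> 1"
  shows "standard_young_tableau n [r] \<longleftrightarrow> r = [1..<n + 1]"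
proof
  assume "standard_young_tableau n [r]"
  then have "sorted_wrt (<) r" "set r = set [1..<n + 1]"
    by (simp_all add: standard_young_tableau_def atLeastLessThanSuc_atLeastAtMost del: upt_Suc)
  then show "r = [1..<n + 1]"
    using strict_sorted_equal[of r "[1..<n + 1]"] by (simp del: upt_Suc)
next
  assume r: "r = [1..<n + 1]"
  have "[] \<noteq> [1..<n + 1]"
    using assms by simp
  with r show "standard_young_tableau n [r]"
    by (simp add: standard_young_tableau_def atLeastLessThanSuc_atLeastAtMost del: upt_Suc)
qed

lemma second_row_two_row_tableau:
  assumes "B \<subseteq> {1..n}"
  shows "set (second_row (two_row_tableau n B)) = B"
proof -
  have "finite B" using assms by (rule finite_subset) simp
  then show ?thesis by (simp add: two_row_tableau_def second_row_def)
qed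

lemma bij_betw_two_row_tableau:
  assumes n: "n \<ge> 1"
  shows "bij_betw (two_row_tableau n) (uncrowded_ballot_sets n) (uncrowded_tableaux n)"
proof (rule bij_betwI')
  show "two_row_tableau n B = two_row_tableau n C \<longleftrightarrow> B = C"
    if "B \<in> uncrowded_ballot_sets n" "C \<in> uncrowded_ballot_sets n" for B C
    using that second_row_two_row_tableau by (metis (mono_tags, lifting) CollectD uncrowded_ballot_sets_def)
next
  fix B assume B: "B \<in> uncrowded_ballot_sets n"
  then have sub: "B \<subseteq> {1..n}" and ballot: "\<forall>v\<le>n. 2 * card (B \<inter> {..v}) \<le> v"
    and unc: "uncrowded (int ` B)"
    by (auto simp: uncrowded_ballot_sets_def)
  have fin: "finite B" using sub by (rule finite_subset) simp
  have "standard_young_tableau n (two_row_tableau n B)"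
  proof (cases "B = {}")
    case True
    then show ?thesis
      using one_row_standard_iff[OF n] by (simp add: two_row_tableau_def)
  next
    case False
    then have "sorted_list_of_set B \<noteq> []" using fin by simp
    then show ?thesis
      using False fin sub ballot two_rows_standard_iff
      by (auto simp: two_row_tableau_def)
  qed
  moreover have "length (two_row_tableau n B) \<le> 2"
    by (simp add: two_row_tableau_def)
  ultimately show "two_row_tableau n B \<in> uncrowded_tableaux n"
    using unc second_row_two_row_tableau[OF sub] by (simp add: uncrowded_tableaux_def)
next
  fix T assume "T \<in> uncrowded_tableaux n"
  then have T: "standard_young_tableau n T" "length T \<le> 2" "uncrowded (int ` set (second_row T))"
    by (auto simp: uncrowded_tableaux_def)
  then have "T \<noteq> []"
    using n by (auto simp: standard_young_tableau_def)
  then consider r where "T = [r]" | r s where "T = [r, s]"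
    using T(2) by (cases T rule: list.exhaust; cases "tl T"; cases "tl (tl T)") auto
  then show "\<exists>B\<in>uncrowded_ballot_sets n. T = two_row_tableau n B"
  proof cases
    case 1
    have "{} \<in> uncrowded_ballot_sets n"
      using T(3) 1 by (simp add: uncrowded_ballot_sets_def second_row_def)
    moreover have "T = two_row_tableau n {}"
      using T(1) 1 one_row_standard_iff[OF n] by (simp add: two_row_tableau_def)
    ultimately show ?thesis by blast
  next
    case 2
    then have "s \<noteq> []" using T(1) by (auto simp: standard_young_tableau_def)
    then have rs: "sorted_wrt (<) r" "sorted_wrt (<) s" "set r \<inter> set s = {}"
      "set r \<union> set s = {1..n}" "\<forall>v\<le>n. 2 * card (set s \<inter> {..v}) \<le> v"
      using T(1) 2 two_rows_standard_iff by auto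
    then have "set s \<in> uncrowded_ballot_sets n"
      using T(3) 2 by (auto simp: uncrowded_ballot_sets_def second_row_def)
    moreover have "{1..n} - set s = set r" using rs by blast
    then have "T = two_row_tableau n (set s)"
      using 2 rs \<open>s \<noteq> []\<close>
      by (simp add: two_row_tableau_def sorted_list_of_set.idem_if_sorted_distinct strict_sorted_iff)
    ultimately show ?thesis by blast
  qed
qed

section \<open>The bijection\<close>

lemma word_tableau_eq:
  assumes x: "x \<in> odd_block_words n" and n: "n \<ge> 1"
  shows "word_tableau n x = two_row_tableau n (beta n x)"
proof -
  have len: "length x = n - 1" using odd_block_wordsD(1)[OF x] .
  have "(\<forall>l\<in>set x. l = 0) \<longleftrightarrow> beta n x = {}"
  proof
    assume zero: "\<forall>l\<in>set x. l = 0"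
    have "\<not> maximal_block x i j" for i j
    proof
      assume "maximal_block x i j"
      then have "x ! (i - 1) = 1" "i - 1 < length x"
        by (auto simp: maximal_block_def letter_def)
      then show False using zero nth_mem by force
    qed
    then show "beta n x = {}" by (simp add: beta_def)
  next
    assume empty: "beta n x = {}"
    show "\<forall>l\<in>set x. l = 0"
    proof (rule ccontr)
      assume "\<not> ?thesis"
      then obtain i where "i < length x" "x ! i = 1"
        using odd_block_wordsD(2)[OF x] by (fastforce simp: in_set_conv_nth)
      then obtain a b where ab: "maximal_block x a b"
        by (auto simp: letter_def intro: in_maximal_block[of "Suc i" x])
      have "odd (b - a + 1)"
        using odd_block_wordsD(3)[OF x ab] .
      then have "even (b - a)" by simp
      then obtain k where "b - a = 2 * k" by blast
      moreover have "a \<le> b"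
        using ab by (simp add: maximal_block_def)
      ultimately have "b = a + 2 * k" by simp
      then show False using ab empty unfolding beta_def by blast
    qed
  qed
  then show ?thesis
    by (simp add: word_tableau_def two_row_tableau_def alpha_eq_complement[OF x n])
qed

theorem proposition6p2:
  fixes n :: nat
  assumes "n \<ge> 1"
  shows "bij_betw (word_tableau n) (odd_block_words n) (uncrowded_tableaux n)"
proof -
  have "bij_betw (two_row_tableau n \<circ> beta n) (odd_block_words n) (uncrowded_tableaux n)"
    using bij_betw_beta[OF assms] bij_betw_two_row_tableau[OF assms] by (rule bij_betw_trans)
  then show ?thesis
    using word_tableau_eq[OF _ assms] by (subst bij_betw_cong) simp_all
qed

end
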